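(* Let $H$ be a transfer Krull monoid over a finite cyclic group $G$ of order $n\ge 3$. Then $n-2\in\Delta_{\rho}^*(H)=\Delta_{\rho}(H)$.
   Context: $\mathbb N$ denotes the positive integers, $\mathbb N_0=\mathbb N\cup\{0\}$. A monoid is an associative semigroup with unit element; $H^{\times}$ is the group of invertible elements of a monoid $H$. $H$ is unit-cancellative if $au=a$ or $ua=a$ (with $a,u\in H$) implies $u\in H^{\times}$. An atom is an element $u\in H\setminus H^{\times}$ such that $u=ab$ with $a,b\in H$ implies $a\in H^\times$ or $b\in H^\times$; $\mathcal A(H)$ is the set of atoms; $H$ is atomic if every non-unit is a finite product of atoms. For $a\in H\setminus H^\times$, $\mathsf L_H(a)=\mathsf L(a)$ is the set of all $k\in\mathbb N$ such that $a$ is a product of $k$ atoms; $\mathsf L(a)=\{0\}$ for $a\in H^\times$; $\mathcal L(H)=\{\mathsf L(a)\mid a\in H\}$. For nonempty $L\subset\mathbb N$ put $\rho(L)=\sup L/\min L$, and $\rho(\{0\})=1$; $\rho(H)=\sup\{\rho(L)\mid L\in\mathcal L(H)\}$. A set $L\subset\mathbb Z$ is an AAP with difference $d\in\mathbb N$ and length $\ell\in\mathbb N_0$ if $L=y+(L'\cup\{0,d,\ldots,\ell d\}\cup L'')\subset y+d\mathbb Z$ for some $y\in\mathbb Z$ and finite sets $L',L''$ with $L'\subset[-M,-1]$ and $L''\subset \ell d+[1,M]$ for some $M\in\mathbb N_0$. $\Delta_\rho(H)$ is the set of all $d\in\mathbb N$ such that for every $k\in\mathbb N$ there is some $L_k\in\mathcal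 L(H)$ which is an AAP with difference $d$, length at least $k$, and $\rho(L_k)=\rho(H)$. For a finite set $L=\{m_1<\ldots<m_k\}\subset\mathbb Z$, $\Delta(L)=\{m_i-m_{i-1}\mid 2\le i\le k\}$. For $S\subset H$, $\Delta_H(S)=\bigcup_{a\in S}\Delta(\mathsf L_H(a))$. For $a\in H$, $[a]=\{a^k\mid k\in\mathbb N_0\}$. Finally $\Delta_\rho^*(H)=\{\min\Delta_H([a])\mid a\in H,\ \rho(\mathsf L(a))=\rho(H)\}$ (where only $a$ with $\Delta_H([a])\ne\emptyset$ contribute; this is automatic if $\rho(H)>1$). For an additive abelian group $G$, $\mathcal F(G)$ is the free abelian monoid with basis $G$ (written multiplicatively, elements $S=g_1\cdots g_\ell$), and $\mathcal B(G)=\{g_1\cdots g_\ell\in\mathcal F(G)\mid g_1+\ldots+g_\ell=0\}$ is the monoid of zero-sum sequences. A monoid homomorphism $\theta\colon H\to B$ between atomic monoids is a weak transfer homomorphism if (T1) $B=B^\times\theta(H)B^\times$ and $\theta^{-1}(B^\times)=H^\times$; (WT2) whenever $a\in H$, $n\in\mathbb N$, $v_1,\ldots,v_n\in\mathcal A(B)$ and $\theta(a)=v_1\cdots v_n$, there are $u_1,\ldots,u_n\in\mathcal A(H)$ and a permutation $\tau$ of $\{1,\ldots,n\}$ with $a=u_1\cdots u_n$ and $\theta(u_i)\in B^\times v_{\tau(i)}B^\times$ for all $i$. A transfer Krull monoid over $G$ is an atomic unit-cancellative monoid $H$ admitting a weak transfer homomorphism $\theta\colon H\to\mathcal B(G)$.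 *)

theory Defs
  imports
    "HOL-Algebra.Elementary_Groups"
    "HOL-Algebra.Divisibility"
    "HOL-Algebra.FiniteProduct"
    "HOL-Combinatorics.Permutations"
    "HOL-Library.Multiset"
    "HOL-Library.Extended_Real"
begin

section \<open>Factorizations in (not necessarily commutative) monoids\<close>

definition unit_cancellative :: "('a, 'm) monoid_scheme \<Rightarrow> bool" where
  "unit_cancellative H \<longleftrightarrow>
     (\<forall>a \<in> carrier H. \<forall>u \<in> carrier H.
        a \<otimes>\<^bsub>H\<^esub> u = a \<or> u \<otimes>\<^bsub>H\<^esub> a = a \<longrightarrow> u \<in> Units H)"

text \<open>The library notion \<^const>\<open>irreducible\<close> is phrased through one-sided divisibility and is
  adequate only for commutative monoids, so atoms are introduced directly.\<close>

definition atoms :: "('a, 'm) monoid_scheme \<Rightarrow> 'a set" where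
  "atoms H = {u \<in> carrier H - Units H.
     \<forall>a \<in> carrier H. \<forall>b \<in> carrier H. u = a \<otimes>\<^bsub>H\<^esub> b \<longrightarrow> a \<in> Units H \<or> b \<in> Units H}"

definition list_prod :: "('a, 'm) monoid_scheme \<Rightarrow> 'a list \<Rightarrow> 'a" where
  "list_prod H xs = foldr (\<otimes>\<^bsub>H\<^esub>) xs \<one>\<^bsub>H\<^esub>"

definition atomic_monoid :: "('a, 'm) monoid_scheme \<Rightarrow> bool" where
  "atomic_monoid H \<longleftrightarrow> monoid H \<and>
     (\<forall>a \<in> carrier H - Units H. \<exists>us. set us \<subseteq> atoms H \<and> a = list_prod H us)"

definition length_set :: "('a, 'm) monoid_scheme \<Rightarrow> 'a \<Rightarrow> nat set" where
  "length_set H a =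
     (if a \<in> Units H then {0}
      else {k. k \<ge> 1 \<and> (\<exists>us. length us = k \<and> set us \<subseteq> atoms H \<and> a = list_prod H us)})"

definition length_sets :: "('a, 'm) monoid_scheme \<Rightarrow> nat set set" where
  "length_sets H = length_set H ` carrier H"

text \<open>Elasticities live in the extended reals, since sets of lengths may be infinite. On sets of
  natural numbers \<^const>\<open>Inf\<close> is the minimum.\<close>

definition set_elasticity :: "nat set \<Rightarrow> ereal" where
  "set_elasticity L =
     (if L = {0} then 1 else (SUP k\<in>L. ereal (real k)) / ereal (real (Inf L)))"

definition elasticity :: "('a, 'm) monoid_scheme \<Rightarrow> ereal" where
  "elasticity H = (SUP L\<in>length_sets H. set_elasticity L)"

definition is_AAP :: "int set \<Rightarrow> nat \<Rightarrow> nat \<Rightarrow> bool" where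
  "is_AAP L d l \<longleftrightarrow> d \<ge> 1 \<and>
     (\<exists>(y::int) L' L'' (M::nat).
        finite L' \<and> L' \<subseteq> {- int M..-1} \<and>
        finite L'' \<and> L'' \<subseteq> (\<lambda>m. int l * int d + m) ` {1..int M} \<and>
        L = (\<lambda>x. y + x) ` (L' \<union> (\<lambda>i. int i * int d) ` {0..l} \<union> L'') \<and>
        L \<subseteq> range (\<lambda>z. y + int d * z))"

definition Delta_rho :: "('a, 'm) monoid_scheme \<Rightarrow> nat set" where
  "Delta_rho H = {d. d \<ge> 1 \<and>
     (\<forall>k\<ge>1. \<exists>L \<in> length_sets H. \<exists>l\<ge>k.
        is_AAP (int ` L) d l \<and> set_elasticity L = elasticity H)}"

definition distances :: "nat set \<Rightarrow> nat set" where
  "distances L = {n - m | m n. m \<in> L \<and> n \<in> L \<and> m < n \<and> \<not> (\<exists>k \<in> L. m < k \<and> k < n)}"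

definition Delta_on :: "('a, 'm) monoid_scheme \<Rightarrow> 'a set \<Rightarrow> nat set" where
  "Delta_on H S = (\<Union>a\<in>S. distances (length_set H a))"

definition powers :: "('a, 'm) monoid_scheme \<Rightarrow> 'a \<Rightarrow> 'a set" where
  "powers H a = range (\<lambda>k::nat. a [^]\<^bsub>H\<^esub> k)"

definition Delta_rho_star :: "('a, 'm) monoid_scheme \<Rightarrow> nat set" where
  "Delta_rho_star H = {Inf (Delta_on H (powers H a)) | a.
     a \<in> carrier H \<and> set_elasticity (length_set H a) = elasticity H \<and>
     Delta_on H (powers H a) \<noteq> {}}"

section \<open>Transfer Krull monoids\<close>

text \<open>Sequences over \<open>G\<close> are multisets with elements in \<^term>\<open>carrier G\<close>. The abelian group \<open>G\<close> is
  written multiplicatively, so the sum of a sequence is a product in \<open>G\<close> and ``zero-sum'' means that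
  this product is \<^term>\<open>\<one>\<^bsub>G\<^esub>\<close>.\<close>

definition seq_sum :: "('g, 'n) monoid_scheme \<Rightarrow> 'g multiset \<Rightarrow> 'g" where
  "seq_sum G S = (\<Otimes>\<^bsub>G\<^esub>g\<in>set_mset S. g [^]\<^bsub>G\<^esub> count S g)"

definition zero_sum_monoid :: "('g, 'n) monoid_scheme \<Rightarrow> 'g multiset monoid" where
  "zero_sum_monoid G =
     \<lparr>carrier = {S. set_mset S \<subseteq> carrier G \<and> seq_sum G S = \<one>\<^bsub>G\<^esub>}, monoid.mult = (+), one = {#}\<rparr>"

definition unit_multiples :: "('a, 'm) monoid_scheme \<Rightarrow> 'a \<Rightarrow> 'a set" where
  "unit_multiples B v = {e \<otimes>\<^bsub>B\<^esub> v \<otimes>\<^bsub>B\<^esub> f | e f. e \<in> Units B \<and> f \<in> Units B}"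

text \<open>\<^const>\<open>hom\<close> does not demand preservation of the unit element, so this is added.\<close>

definition weak_transfer_hom ::
  "('a, 'm) monoid_scheme \<Rightarrow> ('b, 'n) monoid_scheme \<Rightarrow> ('a \<Rightarrow> 'b) \<Rightarrow> bool" where
  "weak_transfer_hom H B \<theta> \<longleftrightarrow>
     atomic_monoid H \<and> atomic_monoid B \<and>
     \<theta> \<in> hom H B \<and> \<theta> \<one>\<^bsub>H\<^esub> = \<one>\<^bsub>B\<^esub> \<and>
     carrier B = (\<Union>a\<in>carrier H. unit_multiples B (\<theta> a)) \<and>
     {a \<in> carrier H. \<theta> a \<in> Units B} = Units H \<and>
     (\<forall>a \<in> carrier H. \<forall>vs.
        vs \<noteq> [] \<and> set vs \<subseteq> atoms B \<and> \<theta> a = list_prod B vs \<longrightarrow>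
        (\<exists>us \<tau>. length us = length vs \<and> set us \<subseteq> atoms H \<and>
           \<tau> permutes {..<length vs} \<and> a = list_prod H us \<and>
           (\<forall>i<length vs. \<theta> (us ! i) \<in> unit_multiples B (vs ! \<tau> i))))"

definition transfer_krull_monoid ::
  "('a, 'm) monoid_scheme \<Rightarrow> ('g, 'n) monoid_scheme \<Rightarrow> bool" where
  "transfer_krull_monoid H G \<longleftrightarrow>
     atomic_monoid H \<and> unit_cancellative H \<and>
     (\<exists>\<theta>. weak_transfer_hom H (zero_sum_monoid G) \<theta>)"

end

theory Submission
  imports Defs "HOL-Algebra.Multiplicative_Group"
begin

text \<open>
  Write \<open>n\<close> for the order of the cyclic group \<open>G\<close>. The monoid of zero-sum sequences over \<open>G\<close> is
  commutative and reduced, so a weak transfer homomorphism into it preserves sets of lengths, and both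
  sets of differences may be computed for zero-sum sequences (\<open>Delta_rho_eq\<close>, \<open>Delta_rho_star_eq\<close>).

  An atom has length at most \<open>n\<close>, and length at least two unless it is the neutral element. The
  elasticity is therefore \<open>n / 2\<close>, and a sequence \<open>A\<close> attains it only if it has a factorization
  into atoms of length \<open>n\<close>. An atom of length \<open>n\<close> is an \<open>n\<close>-th power of a generator
  (\<open>long_atom\<close>), so every element in the support of \<open>A\<close> is a generator and occurs at least \<open>n\<close>
  times (\<open>extremal_support\<close>).

  The main tool is the index: for a generator \<open>g\<close> add up the exponents \<open>e(x) \<in> {1..n}\<close> with
  \<open>x = e(x) g\<close> over all terms \<open>x\<close> of the sequence and divide by \<open>n\<close>. For an atom \<open>V\<close> of length \<open>l\<close>
  and index \<open>q\<close>, the product of \<open>V\<close> with \<open>l - q\<close> copies of \<open>g\<^sup>n\<close> is also the product of the \<open>l\<close>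
  atoms \<open>x g\<^bsup>n-e(x)\<^esup>\<close>, where \<open>x\<close> runs over the terms of \<open>V\<close>. The two lengths differ by \<open>q - 1\<close>. So
  if all lengths of \<open>A\<close> agree modulo \<open>d\<close>, and \<open>A\<close> is divisible by this product, then \<open>q\<close> is one
  modulo \<open>d\<close> (\<open>atom_index_cong\<close>). Conversely, if all atoms over the support of \<open>A\<close> have index one
  modulo \<open>d\<close>, then the additive index determines the lengths of every power of \<open>A\<close> modulo \<open>d\<close>
  (\<open>length_cong_index\<close>).

  Now let \<open>d\<close> be a difference of arbitrarily long progressions of maximal elasticity. A sequence \<open>A\<close>
  with a sufficiently long progression is itself long, so it contains some generator \<open>g\<close> often enough
  for the padded atoms to divide it, and the two observations together show that \<open>d\<close> divides all
  distances in powers of \<open>A\<close>. As \<open>d\<close> is a distance of \<open>A\<close>, it is the minimal one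
  (\<open>Delta_rho_subset\<close>). The converse inclusion holds because the minimal distance in powers of an
  element divides all others, and because sumsets of pairs \<open>{x, x + d}\<close> are progressions
  (\<open>Delta_rho_star_subset\<close>). Finally, for \<open>A = g\<^sup>n (-g)\<^sup>n\<close> the atoms over the support have index
  \<open>1\<close> or \<open>n - 1\<close>, and \<open>2\<close> and \<open>n\<close> are lengths of \<open>A\<close>, so \<open>n - 2\<close> is the minimal distance.
\<close>

section \<open>Distances and elasticities of sets of lengths\<close>

text \<open>A set of lengths may have elements strictly between \<open>x\<close> and \<open>y\<close>; the least element beyond \<open>x\<close>
  is its successor, so a distance of size at most \<open>y - x\<close> always occurs.\<close>

lemma distances_obtain:
  assumes "x \<in> L" "y \<in> L" "x < y"
  obtains z where "z \<in> L" "x < z" "z \<le> y" "z - x \<in> distances L"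
proof -
  define z where "z = (LEAST z. z \<in> L \<and> x < z)"
  have z: "z \<in> L \<and> x < z"
    unfolding z_def by (rule LeastI[of _ y]) (use assms in auto)
  have le: "z \<le> w" if "w \<in> L" "x < w" for w
    unfolding z_def by (rule Least_le) (use that in auto)
  have "z - x \<in> distances L"
    unfolding distances_def using z le assms(1) by fastforce
  with z le[OF assms(2,3)] that show ?thesis by blast
qed

lemma dvd_diff_if_dvd_distances:
  assumes "\<And>e. e \<in> distances L \<Longrightarrow> d dvd e" and "x \<in> L" "y \<in> L"
  shows "int d dvd int x - int y"
proof -
  have up: "d dvd v - u" if "u \<in> L" "v \<in> L" "u \<le> v" for u v
    using that
  proof (induction "v - u" arbitrary: u rule: less_induct)
    case less
    show ?case
    proof (cases "u = v")
      case False
      with less.prems have "u < v" by simp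
      then obtain z where z: "z \<in> L" "u < z" "z \<le> v" "z - u \<in> distances L"
        using distances_obtain less.prems by metis
      have "d dvd v - z" using less.hyps[of z] z less.prems \<open>u < v\<close> by auto
      moreover have "d dvd z - u" using assms(1) z(4) .
      moreover have "v - u = (v - z) + (z - u)" using z by simp
      ultimately show ?thesis by (metis dvd_add)
    qed simp
  qed
  show ?thesis
  proof (cases "y \<le> x")
    case True
    then show ?thesis using up[OF assms(3,2)] by (metis of_nat_diff of_nat_dvd_iff)
  next
    case False
    then have "int d dvd int y - int x"
      using up[OF assms(2,3)] by (metis nat_le_linear of_nat_diff of_nat_dvd_iff)
    then show ?thesis by (metis dvd_minus_iff minus_diff_eq)
  qed
qed

lemma mem_distancesE:
  assumes "e \<in> distances L"
  obtains x where "x \<in> L" "x + e \<in> L" "e > 0"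
proof -
  from assms obtain m n where "e = n - m" "m \<in> L" "n \<in> L" "m < n"
    unfolding distances_def by auto
  then show ?thesis using that[of m] by auto
qed

lemma Inf_multiples:
  assumes "d \<in> D" and "\<And>e. e \<in> D \<Longrightarrow> d dvd e \<and> e > (0::nat)"
  shows "Inf D = d"
proof -
  have "Inf D \<in> D" using assms(1) Inf_nat_def1 by blast
  then have "d \<le> Inf D" using assms(2) dvd_imp_le by blast
  moreover have "Inf D \<le> d" using assms(1) wellorder_Inf_le1 by blast
  ultimately show ?thesis by simp
qed

text \<open>The end parts of an almost arithmetical progression are finite but otherwise arbitrary, and the
  bound \<open>M\<close> may depend on the set. For a finite set of naturals being an AAP therefore amounts to
  containing a progression of the given length and lying in one residue class modulo \<open>d\<close>.\<close>

lemma is_AAP_image_int_iff: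
  assumes "finite L"
  shows "is_AAP (int ` L) d l \<longleftrightarrow>
    d \<ge> 1 \<and> (\<exists>y. (\<forall>i\<le>l. y + i * d \<in> L) \<and> (\<forall>x\<in>L. int d dvd int x - int y))"
proof
  assume "is_AAP (int ` L) d l"
  then obtain y L' L'' where d: "d \<ge> 1"
    and L: "int ` L = (\<lambda>x. y + x) ` (L' \<union> (\<lambda>i. int i * int d) ` {0..l} \<union> L'')"
    and sub: "int ` L \<subseteq> range (\<lambda>z. y + int d * z)"
    unfolding is_AAP_def by (elim conjE exE, intro that)
  have mem: "y + int i * int d \<in> int ` L" if "i \<le> l" for i
    unfolding L by (rule imageI) (use that in auto)
  obtain z where z: "y = int z" using mem[of 0] by auto
  have "z + i * d \<in> L" if "i \<le> l" for i
  proof -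
    have "int (z + i * d) \<in> int ` L" using mem[OF that] z by simp
    then show ?thesis by (metis image_iff of_nat_eq_iff)
  qed
  moreover have "int d dvd int x - int z" if "x \<in> L" for x
  proof -
    have "int x \<in> range (\<lambda>z. y + int d * z)" using sub that by blast
    then show ?thesis using z by auto
  qed
  ultimately show "d \<ge> 1 \<and> (\<exists>y. (\<forall>i\<le>l. y + i * d \<in> L) \<and> (\<forall>x\<in>L. int d dvd int x - int y))"
    using d by blast
next
  assume "d \<ge> 1 \<and> (\<exists>y. (\<forall>i\<le>l. y + i * d \<in> L) \<and> (\<forall>x\<in>L. int d dvd int x - int y))"
  then obtain y where d: "d \<ge> 1" and AP: "\<And>i. i \<le> l \<Longrightarrow> y + i * d \<in> L"
    and dv: "\<And>x. x \<in> L \<Longrightarrow> int d dvd int x - int y" by auto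
  define M where "M = Max L + y"
  have M: "x \<le> M" if "x \<in> L" for x
    using Max_ge[OF assms that] by (simp add: M_def)
  define L' where "L' = (\<lambda>x. int x - int y) ` {x \<in> L. x < y}"
  define L'' where "L'' = (\<lambda>x. int x - int y) ` {x \<in> L. y + l * d < x}"
  have 1: "L' \<subseteq> {- int M..-1}" unfolding L'_def M_def by auto
  have 2: "L'' \<subseteq> (\<lambda>m. int l * int d + m) ` {1..int M}"
  proof
    fix z assume "z \<in> L''"
    then obtain x where x: "x \<in> L" "y + l * d < x" "z = int x - int y"
      unfolding L''_def by auto
    have "int (y + l * d) < int x" using x(2) by linarith
    moreover have "0 \<le> int (l * d)" "int x \<le> int M" using M[OF x(1)] by simp_all
    ultimately have "1 \<le> z - int (l * d)" "z - int (l * d) \<le> int M" using x(3) by linarith+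
    then have "z - int l * int d \<in> {1..int M}" by simp
    then show "z \<in> (\<lambda>m. int l * int d + m) ` {1..int M}"
      by (intro image_eqI[of _ _ "z - int l * int d"]) auto
  qed
  have 3: "int ` L = (\<lambda>x. int y + x) ` (L' \<union> (\<lambda>i. int i * int d) ` {0..l} \<union> L'')" (is "_ = ?R")
  proof
    show "int ` L \<subseteq> ?R"
    proof
      fix w assume "w \<in> int ` L"
      then obtain x where x: "x \<in> L" "w = int x" by auto
      consider "x < y" | "y + l * d < x" | "y \<le> x" "x \<le> y + l * d" by linarith
      then have "int x - int y \<in> L' \<union> (\<lambda>i. int i * int d) ` {0..l} \<union> L''"
      proof cases
        case 3
        have "d dvd x - y" using dv[OF x(1)] 3 by (metis of_nat_diff of_nat_dvd_iff)
        then obtain i where i: "x - y = d * i" by auto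
        then have "d * i \<le> d * l" using 3 by (metis le_diff_conv2 diff_le_mono diff_add_inverse mult.commute)
        then have "i \<le> l" using d by simp
        moreover have "int x - int y = int i * int d"
          using i 3 by (metis mult.commute of_nat_diff of_nat_mult)
        ultimately show ?thesis by auto
      qed (use x in \<open>auto simp: L'_def L''_def\<close>)
      then show "w \<in> ?R" using x(2) by (intro image_eqI[of _ _ "int x - int y"]) auto
    qed
    show "?R \<subseteq> int ` L"
    proof
      fix w assume "w \<in> ?R"
      then obtain v where v: "w = int y + v" "v \<in> L' \<union> (\<lambda>i. int i * int d) ` {0..l} \<union> L''" by auto
      show "w \<in> int ` L"
      proof (cases "v \<in> L' \<union> L''")
        case True
        then obtain x where "x \<in> L" "v = int x - int y" by (auto simp: L'_def L''_def)
        then show ?thesis using v(1) by simp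
      next
        case False
        then obtain i where "i \<le> l" "v = int i * int d" using v(2) by auto
        then show ?thesis using AP[of i] v(1) by (intro image_eqI[of _ _ "y + i * d"]) auto
      qed
    qed
  qed
  have 4: "int ` L \<subseteq> range (\<lambda>z. int y + int d * z)"
  proof
    fix w assume "w \<in> int ` L"
    then obtain x where x: "x \<in> L" "w = int x" by auto
    obtain z where "int x - int y = int d * z" using dv[OF x(1)] by (auto elim: dvdE)
    then show "w \<in> range (\<lambda>z. int y + int d * z)" using x(2) by (intro image_eqI[of _ _ z]) auto
  qed
  have "finite L'" "finite L''" using assms by (auto simp: L'_def L''_def)
  then show "is_AAP (int ` L) d l"
    unfolding is_AAP_def using d 1 2 3 4
    by (intro conjI exI[of _ "int y"] exI[of _ L'] exI[of _ L''] exI[of _ M])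
qed

lemma set_elasticity_finite:
  assumes "finite L" "L \<noteq> {}" "0 \<notin> L"
  shows "set_elasticity L = ereal (real (Max L) / real (Min L))"
proof -
  have "(SUP k\<in>L. ereal (real k)) = ereal (real (Max L))"
  proof (rule antisym)
    show "(SUP k\<in>L. ereal (real k)) \<le> ereal (real (Max L))"
      by (rule SUP_least) (use assms in auto)
    show "ereal (real (Max L)) \<le> (SUP k\<in>L. ereal (real k))"
      by (rule SUP_upper) (use assms in auto)
  qed
  moreover have "Inf L = Min L" using assms by (metis cInf_eq_Min)
  moreover have "L \<noteq> {0}" using assms by auto
  moreover have "Min L \<noteq> 0" using assms by (metis Min_in)
  ultimately show ?thesis by (simp add: set_elasticity_def)
qed

section \<open>Weak transfer homomorphisms preserve sets of lengths\<close>

lemma list_prod_Cons: "list_prod H (x # xs) = x \<otimes>\<^bsub>H\<^esub> list_prod H xs"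
  by (simp add: list_prod_def)

lemma list_prod_Nil: "list_prod H [] = \<one>\<^bsub>H\<^esub>"
  by (simp add: list_prod_def)

lemma list_prod_closed:
  assumes "monoid H" "set xs \<subseteq> carrier H"
  shows "list_prod H xs \<in> carrier H"
  using assms(2) by (induction xs)
    (auto simp: list_prod_Cons list_prod_Nil assms(1) monoid.m_closed monoid.one_closed)

text \<open>If the target is commutative and its only unit is the identity, then unit multiples are
  trivial: \<open>\<theta>\<close> is surjective and factorizations lift exactly. Hence all invariants defined through
  sets of lengths agree for \<open>H\<close> and \<open>B\<close>.\<close>

locale reduced_weak_transfer =
  fixes H :: "('a, 'm) monoid_scheme" and B :: "('b, 'n) monoid_scheme" and \<theta>
  assumes wth: "weak_transfer_hom H B \<theta>"
    and comm: "comm_monoid B"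
    and reduced: "Units B = {\<one>\<^bsub>B\<^esub>}"
begin

interpretation B: comm_monoid B by (rule comm)

lemma monoid_H: "monoid H" and hom: "\<theta> \<in> hom H B" and theta_one: "\<theta> \<one>\<^bsub>H\<^esub> = \<one>\<^bsub>B\<^esub>"
  using wth by (auto simp: weak_transfer_hom_def atomic_monoid_def)

interpretation H: monoid H by (rule monoid_H)

lemma theta_closed: "a \<in> carrier H \<Longrightarrow> \<theta> a \<in> carrier B"
  using hom by (auto simp: hom_def)

lemma unit_multiples_eq: "v \<in> carrier B \<Longrightarrow> unit_multiples B v = {v}"
  by (auto simp: unit_multiples_def reduced)

lemma theta_surj: "\<theta> ` carrier H = carrier B"
proof -
  have "carrier B = (\<Union>a\<in>carrier H. unit_multiples B (\<theta> a))"
    using wth by (simp add: weak_transfer_hom_def)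
  also have "\<dots> = (\<Union>a\<in>carrier H. {\<theta> a})"
    using unit_multiples_eq theta_closed by simp
  finally show ?thesis by auto
qed

lemma theta_unit_iff: "a \<in> carrier H \<Longrightarrow> \<theta> a = \<one>\<^bsub>B\<^esub> \<longleftrightarrow> a \<in> Units H"
  using wth reduced by (auto simp: weak_transfer_hom_def)

lemma lift_factorization:
  assumes "a \<in> carrier H" "vs \<noteq> []" "set vs \<subseteq> atoms B" "\<theta> a = list_prod B vs"
  obtains us where "length us = length vs" "set us \<subseteq> atoms H" "a = list_prod H us"
    "\<forall>i<length vs. \<exists>j<length vs. \<theta> (us ! i) = vs ! j"
proof -
  obtain us \<tau> where us: "length us = length vs" "set us \<subseteq> atoms H" "a = list_prod H us"
    and \<tau>: "\<tau> permutes {..<length vs}"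
    and *: "\<forall>i<length vs. \<theta> (us ! i) \<in> unit_multiples B (vs ! \<tau> i)"
    using wth assms unfolding weak_transfer_hom_def by meson
  have "\<theta> (us ! i) = vs ! \<tau> i \<and> \<tau> i < length vs" if "i < length vs" for i
  proof -
    have "\<tau> i < length vs" using \<tau> that by (metis lessThan_iff permutes_in_image)
    moreover from this have "vs ! \<tau> i \<in> carrier B"
      using assms(3) by (auto simp: atoms_def dest!: nth_mem)
    ultimately show ?thesis using * that unit_multiples_eq by auto
  qed
  then show ?thesis using that us by blast
qed

text \<open>Lifting a factorization of \<open>\<theta> u\<close> into two or more atoms would factor the atom \<open>u\<close> into two
  or more atoms.\<close>

lemma theta_atom:
  assumes u: "u \<in> atoms H"
  shows "\<theta> u \<in> atoms B"
proof -
  have uH: "u \<in> carrier H" "u \<notin> Units H" using u by (auto simp: atoms_def)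
  then have "\<theta> u \<in> carrier B - Units B"
    using theta_closed theta_unit_iff reduced by auto
  then obtain vs where vs: "set vs \<subseteq> atoms B" "\<theta> u = list_prod B vs"
    using wth unfolding weak_transfer_hom_def atomic_monoid_def by meson
  have ne: "vs \<noteq> []"
    using vs uH theta_unit_iff by (auto simp: list_prod_Nil)
  obtain us where us: "length us = length vs" "set us \<subseteq> atoms H" "u = list_prod H us"
    and uv: "\<forall>i<length vs. \<exists>j<length vs. \<theta> (us ! i) = vs ! j"
    using lift_factorization[OF uH(1) ne vs] .
  obtain x rs where xr: "us = x # rs" using us(1) ne by (cases us) auto
  have usH: "set us \<subseteq> carrier H" using us(2) by (auto simp: atoms_def)
  have closed: "list_prod H rs \<in> carrier H" "x \<in> carrier H"
    using list_prod_closed[OF monoid_H] usH xr by auto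
  have "x \<in> Units H \<or> list_prod H rs \<in> Units H"
    using u us(3) closed by (auto simp: atoms_def xr list_prod_Cons)
  moreover have "x \<notin> Units H" using us(2) xr by (auto simp: atoms_def)
  ultimately have unit: "list_prod H rs \<in> Units H" by simp
  have "rs = []"
  proof (cases rs)
    case (Cons r rs')
    have r: "r \<in> carrier H" "r \<notin> Units H" "list_prod H rs' \<in> carrier H"
      using us(2) xr Cons list_prod_closed[OF monoid_H, of rs'] usH by (auto simp: atoms_def)
    have "\<theta> r \<otimes>\<^bsub>B\<^esub> \<theta> (list_prod H rs') = \<one>\<^bsub>B\<^esub>"
      using unit theta_unit_iff[OF closed(1)] hom r by (simp add: Cons list_prod_Cons hom_def)
    then have "\<theta> r \<in> Units B"
      using B.unit_factor[of "\<theta> r" "\<theta> (list_prod H rs')"] r theta_closed by simp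
    then show ?thesis using theta_unit_iff[OF r(1)] r(2) reduced by simp
  qed simp
  then have "length vs = 1" using us(1) xr by simp
  moreover have "u = us ! 0" using us(3) xr \<open>rs = []\<close> closed by (simp add: list_prod_Cons list_prod_Nil)
  ultimately have "\<theta> u \<in> set vs" using uv by auto
  then show ?thesis using vs(1) by auto
qed

lemma theta_list_prod:
  assumes "set us \<subseteq> carrier H"
  shows "\<theta> (list_prod H us) = list_prod B (map \<theta> us)"
  using assms
proof (induction us)
  case (Cons u us)
  then show ?case
    using hom list_prod_closed[OF monoid_H, of us] by (auto simp: list_prod_Cons hom_def)
qed (simp add: list_prod_Nil theta_one)

lemma length_set_theta:
  assumes a: "a \<in> carrier H"
  shows "length_set B (\<theta> a) = length_set H a"
proof (cases "a \<in> Units H")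
  case True
  then show ?thesis using theta_unit_iff[OF a] reduced by (simp add: length_set_def)
next
  case False
  then have nu: "\<theta> a \<notin> Units B" using theta_unit_iff[OF a] reduced by simp
  have "(\<exists>vs. length vs = k \<and> set vs \<subseteq> atoms B \<and> \<theta> a = list_prod B vs) \<longleftrightarrow>
    (\<exists>us. length us = k \<and> set us \<subseteq> atoms H \<and> a = list_prod H us)" (is "?L = ?R") if "k \<ge> 1" for k
  proof
    assume ?L
    then obtain vs where vs: "length vs = k" "set vs \<subseteq> atoms B" "\<theta> a = list_prod B vs" by blast
    then have "vs \<noteq> []" using that by auto
    then show ?R using lift_factorization[OF a _ vs(2,3)] vs(1) by metis
  next
    assume ?R
    then obtain us where us: "length us = k" "set us \<subseteq> atoms H" "a = list_prod H us" by blast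
    then have "\<theta> a = list_prod B (map \<theta> us)"
      using theta_list_prod by (auto simp: atoms_def)
    then show ?L using us theta_atom by (intro exI[of _ "map \<theta> us"]) auto
  qed
  then show ?thesis using nu False by (auto simp: length_set_def)
qed

lemma length_sets_eq: "length_sets H = length_sets B"
proof -
  have "length_sets B = (\<lambda>a. length_set B (\<theta> a)) ` carrier H"
    unfolding length_sets_def theta_surj[symmetric] by (simp add: image_image)
  also have "\<dots> = length_sets H"
    unfolding length_sets_def using length_set_theta by (intro image_cong) auto
  finally show ?thesis by simp
qed

lemma theta_pow: "a \<in> carrier H \<Longrightarrow> \<theta> (a [^]\<^bsub>H\<^esub> (k::nat)) = \<theta> a [^]\<^bsub>B\<^esub> k"
  using hom by (induction k) (auto simp: theta_one hom_def)

lemma Delta_on_powers_theta: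
  assumes a: "a \<in> carrier H"
  shows "Delta_on B (powers B (\<theta> a)) = Delta_on H (powers H a)"
  unfolding Delta_on_def powers_def
  using length_set_theta[OF H.nat_pow_closed[OF a]] theta_pow[OF a] by simp

lemma Delta_rho_eq: "Delta_rho H = Delta_rho B"
  by (simp add: Delta_rho_def elasticity_def length_sets_eq)

lemma Delta_rho_star_eq: "Delta_rho_star H = Delta_rho_star B"
proof -
  have "Delta_rho_star B = {Inf (Delta_on B (powers B (\<theta> a))) | a.
     a \<in> carrier H \<and> set_elasticity (length_set B (\<theta> a)) = elasticity B \<and>
     Delta_on B (powers B (\<theta> a)) \<noteq> {}}"
    unfolding Delta_rho_star_def theta_surj[symmetric] by blast
  also have "\<dots> = Delta_rho_star H"
    unfolding Delta_rho_star_def elasticity_def length_sets_eq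
    by (intro Collect_cong ex_cong1) (auto simp: length_set_theta Delta_on_powers_theta)
  finally show ?thesis by simp
qed

end

section \<open>Zero-sum sequences over a finite abelian group\<close>

locale finite_comm_group = comm_group +
  assumes finite_carrier: "finite (carrier G)"
begin

abbreviation B where "B \<equiv> zero_sum_monoid G"

lemma seq_sum_finprod:
  assumes "finite U" "set_mset S \<subseteq> U" "U \<subseteq> carrier G"
  shows "seq_sum G S = (\<Otimes>g\<in>U. g [^] count S g)"
  unfolding seq_sum_def
proof (rule finprod_mono_neutral_cong_left)
  show "g [^] count S g = \<one>" if "g \<in> U - set_mset S" for g
    using that by (simp add: not_in_iff)
qed (use assms in auto)

lemma seq_sum_closed:
  assumes "set_mset S \<subseteq> carrier G"
  shows "seq_sum G S \<in> carrier G"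
  unfolding seq_sum_def using assms by (intro finprod_closed) auto

lemma seq_sum_empty [simp]: "seq_sum G {#} = \<one>"
  by (simp add: seq_sum_def)

lemma seq_sum_union:
  assumes "set_mset S \<subseteq> carrier G" "set_mset T \<subseteq> carrier G"
  shows "seq_sum G (S + T) = seq_sum G S \<otimes> seq_sum G T"
proof -
  let ?U = "set_mset S \<union> set_mset T"
  have U: "?U \<subseteq> carrier G" using assms by auto
  have "seq_sum G (S + T) = (\<Otimes>g\<in>?U. g [^] count (S + T) g)"
    using U by (intro seq_sum_finprod) auto
  also have "\<dots> = (\<Otimes>g\<in>?U. g [^] count S g \<otimes> g [^] count T g)"
  proof (rule finprod_cong')
    show "g [^] count (S + T) g = g [^] count S g \<otimes> g [^] count T g" if "g \<in> ?U" for g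
    proof -
      have "g \<in> carrier G" using U that by auto
      then show ?thesis by (simp add: nat_pow_mult)
    qed
  qed (use U in auto)
  also have "\<dots> = (\<Otimes>g\<in>?U. g [^] count S g) \<otimes> (\<Otimes>g\<in>?U. g [^] count T g)"
    using U by (intro finprod_multf) auto
  also have "\<dots> = seq_sum G S \<otimes> seq_sum G T"
    using U by (simp add: seq_sum_finprod[of ?U])
  finally show ?thesis .
qed

lemma seq_sum_single: "g \<in> carrier G \<Longrightarrow> seq_sum G {#g#} = g"
  by (simp add: seq_sum_def)

lemma seq_sum_replicate: "g \<in> carrier G \<Longrightarrow> seq_sum G (replicate_mset k g) = g [^] k"
  by (cases "k = 0") (auto simp: seq_sum_def)

lemma carrier_B: "S \<in> carrier B \<longleftrightarrow> set_mset S \<subseteq> carrier G \<and> seq_sum G S = \<one>"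
  by (simp add: zero_sum_monoid_def)

lemma mult_B [simp]: "S \<otimes>\<^bsub>B\<^esub> T = S + T"
  by (simp add: zero_sum_monoid_def)

lemma one_B [simp]: "\<one>\<^bsub>B\<^esub> = {#}"
  by (simp add: zero_sum_monoid_def)

lemma add_closed_B: "S \<in> carrier B \<Longrightarrow> T \<in> carrier B \<Longrightarrow> S + T \<in> carrier B"
  by (simp add: carrier_B seq_sum_union)

lemma carrier_B_cancel:
  assumes "S \<in> carrier B" "S + T \<in> carrier B"
  shows "T \<in> carrier B"
  using assms seq_sum_union[of S T] seq_sum_closed[of T] by (auto simp: carrier_B)

lemma comm_monoid_B: "comm_monoid B"
  by (rule comm_monoidI) (simp_all add: add_closed_B ac_simps, simp add: carrier_B)

lemma Units_B: "Units B = {{#}}"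
  by (auto simp: Units_def carrier_B)

lemma pow_B: "A [^]\<^bsub>B\<^esub> (m::nat) = repeat_mset m A"
  by (induction m) (auto simp: add.commute)

lemma list_prod_B: "list_prod B xs = sum_list xs"
  by (induction xs) (auto simp: list_prod_def)

text \<open>Divisibility in the monoid of zero-sum sequences is inclusion of multisets, because the complement
  of a zero-sum subsequence is again zero-sum. Atoms are thus the minimal zero-sum sequences.\<close>

lemma atoms_B_iff:
  "V \<in> atoms B \<longleftrightarrow> V \<in> carrier B \<and> V \<noteq> {#} \<and>
     (\<forall>W \<in> carrier B. W \<subseteq># V \<longrightarrow> W = {#} \<or> W = V)" (is "_ \<longleftrightarrow> ?R")
proof
  assume V: "V \<in> atoms B"
  show ?R
  proof (intro conjI ballI impI)
    fix W assume W: "W \<in> carrier B" "W \<subseteq># V"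
    then obtain T where T: "V = W + T" by (metis subset_mset.le_iff_add)
    have "V \<in> carrier B" using V by (simp add: atoms_def)
    then have "T \<in> carrier B" using carrier_B_cancel[OF W(1)] T by simp
    moreover have "\<forall>a\<in>carrier B. \<forall>b\<in>carrier B. V = a + b \<longrightarrow> a = {#} \<or> b = {#}"
      using V by (simp add: atoms_def Units_B)
    ultimately have "W = {#} \<or> T = {#}" using W(1) T by blast
    then show "W = {#} \<or> W = V" using T by auto
  qed (use V in \<open>simp_all add: atoms_def Units_B\<close>)
next
  assume R: ?R
  have "a = {#} \<or> b = {#}" if "a \<in> carrier B" "b \<in> carrier B" "V = a + b" for a b
    using R that by (metis add_cancel_left_right mset_subset_eq_add_left)
  then show "V \<in> atoms B" using R unfolding atoms_def Units_B mult_B by blast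
qed

lemma atom_carrier: "V \<in> atoms B \<Longrightarrow> V \<in> carrier B"
  by (simp add: atoms_def)

lemma atom_support: "V \<in> atoms B \<Longrightarrow> set_mset V \<subseteq> carrier G"
  by (simp add: atoms_def carrier_B)

lemma sum_list_atoms_closed: "set us \<subseteq> atoms B \<Longrightarrow> sum_list us \<in> carrier B"
  by (induction us) (simp_all add: add_closed_B atom_carrier, simp add: carrier_B)

lemma length_le_size_sum_list:
  assumes "set us \<subseteq> atoms B"
  shows "length us \<le> size (sum_list us)"
  using assms
proof (induction us)
  case (Cons u us)
  then have "size u \<ge> 1" by (auto simp: atoms_B_iff Suc_le_eq nonempty_has_size)
  then show ?case using Cons by simp
qed simp

text \<open>The special treatment of units in the definition of sets of lengths is subsumed by allowing the
  empty factorization: in a reduced monoid nothing but the identity has it, and the identity has no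
  other one.\<close>

lemma mem_length_set_B:
  "k \<in> length_set B A \<longleftrightarrow> (\<exists>us. length us = k \<and> set us \<subseteq> atoms B \<and> A = sum_list us)"
proof (cases "A = {#}")
  case True
  have "length us = 0" if "set us \<subseteq> atoms B" "{#} = sum_list us" for us
    using length_le_size_sum_list[OF that(1)] that(2) by simp
  then show ?thesis using True by (force simp: length_set_def Units_B)
next
  case False
  then show ?thesis
    by (auto simp: length_set_def Units_B list_prod_B Suc_le_eq)
qed

lemma length_le_size: "k \<in> length_set B A \<Longrightarrow> k \<le> size A"
  using length_le_size_sum_list by (auto simp: mem_length_set_B)

lemma finite_length_set: "finite (length_set B A)"
  by (rule finite_subset[of _ "{..size A}"]) (auto dest: length_le_size)

lemma length_set_add:
  assumes "k \<in> length_set B A" "l \<in> length_set B A'"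
  shows "k + l \<in> length_set B (A + A')"
proof -
  obtain us vs where "length us = k" "set us \<subseteq> atoms B" "A = sum_list us"
    "length vs = l" "set vs \<subseteq> atoms B" "A' = sum_list vs"
    using assms by (auto simp: mem_length_set_B)
  then show ?thesis by (auto simp: mem_length_set_B intro!: exI[of _ "us @ vs"])
qed

lemma length_set_empty: "0 \<in> length_set B {#}"
  by (auto simp: mem_length_set_B)

lemma length_set_repeat:
  assumes "k \<in> length_set B A"
  shows "m * k \<in> length_set B (repeat_mset m A)"
proof (induction m)
  case (Suc m)
  then show ?case using length_set_add[OF assms Suc] by simp
qed (simp add: length_set_empty)

lemma length_set_nonempty:
  assumes "A \<in> carrier B"
  shows "length_set B A \<noteq> {}"
  using assms
proof (induction "size A" arbitrary: A rule: less_induct)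
  case less
  consider "A = {#}" | "A \<in> atoms B" | W where "W \<in> carrier B" "W \<subseteq># A" "W \<noteq> {#}" "W \<noteq> A"
    using less.prems by (auto simp: atoms_B_iff)
  then show ?case
  proof cases
    case 1
    then show ?thesis using length_set_empty by auto
  next
    case 2
    then have "1 \<in> length_set B A" by (auto simp: mem_length_set_B intro!: exI[of _ "[A]"])
    then show ?thesis by auto
  next
    case 3
    then obtain T where T: "A = W + T" by (metis subset_mset.le_iff_add)
    then have "T \<in> carrier B" using carrier_B_cancel less.prems 3 by blast
    moreover have "size T < size A" "size W < size A" using T 3 by (auto simp: nonempty_has_size)
    ultimately obtain k l where "k \<in> length_set B W" "l \<in> length_set B T"
      using less.hyps 3 by (metis ex_in_conv)
    then show ?thesis using length_set_add T by blast
  qed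
qed

lemma zero_notin_length_set: "A \<noteq> {#} \<Longrightarrow> 0 \<notin> length_set B A"
  by (auto simp: mem_length_set_B)

section \<open>Long atoms\<close>

text \<open>If two of the partial sums agreed, the terms between them would form a nonempty proper zero-sum
  subsequence.\<close>

lemma partial_sums_inj:
  assumes "mset xs \<in> atoms B"
  shows "inj_on (\<lambda>i. seq_sum G (mset (take i xs))) {..<length xs}"
proof -
  have supp: "set xs \<subseteq> carrier G" using atom_support[OF assms] by simp
  have False if ij: "i < j" "j < length xs"
    and eq: "seq_sum G (mset (take i xs)) = seq_sum G (mset (take j xs))" for i j
  proof -
    let ?W = "mset (drop i (take j xs))"
    have sub: "set (take i xs) \<subseteq> carrier G" "set (drop i (take j xs)) \<subseteq> carrier G"
      using supp set_take_subset set_drop_subset by (metis subset_trans)+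
    have "take j xs = take i xs @ drop i (take j xs)"
      using ij by (metis append_take_drop_id min.strict_order_iff min.commute take_take)
    then have "seq_sum G (mset (take j xs)) = seq_sum G (mset (take i xs)) \<otimes> seq_sum G ?W"
      using seq_sum_union[of "mset (take i xs)" ?W] sub by (metis mset_append set_mset_mset)
    then have "seq_sum G ?W = \<one>"
      using eq seq_sum_closed[of "mset (take i xs)"] seq_sum_closed[of ?W] sub by simp
    then have "?W \<in> carrier B" using sub by (simp add: carrier_B)
    moreover have "?W \<subseteq># mset xs"
      by (metis append_take_drop_id mset_append mset_subset_eq_add_left mset_subset_eq_add_right
          subset_mset.order_trans)
    ultimately have "?W = {#} \<or> ?W = mset xs"
      using assms by (auto simp: atoms_B_iff)
    then have "size ?W = 0 \<or> size ?W = length xs" by (metis size_empty size_mset)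
    then show False using ij by simp
  qed
  then show ?thesis by (metis (no_types, lifting) inj_onI lessThan_iff linorder_neqE_nat)
qed

lemma partial_sum_closed:
  assumes "mset xs \<in> atoms B"
  shows "seq_sum G (mset (take i xs)) \<in> carrier G"
  using atom_support[OF assms] set_take_subset[of i xs] by (intro seq_sum_closed) auto

lemma atom_size_le:
  assumes "V \<in> atoms B"
  shows "size V \<le> order G"
proof -
  obtain xs where xs: "V = mset xs" by (metis ex_mset)
  have "card {..<length xs} \<le> card (carrier G)"
    using partial_sums_inj[of xs] partial_sum_closed[of xs] assms xs finite_carrier
    by (intro card_inj_on_le[of "\<lambda>i. seq_sum G (mset (take i xs))"]) auto
  then show ?thesis using xs by (simp add: order_def)
qed

text \<open>The partial sums of an atom of maximal length exhaust the group. Exchanging the first two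
  terms alters none of these sums but the first, so it cannot alter that one either: any two terms
  agree.\<close>

lemma long_atom_terms_eq:
  assumes V: "V \<in> atoms B" "size V = order G" and xy: "x \<in># V" "y \<in># V"
  shows "x = y"
proof (rule ccontr)
  assume ne: "x \<noteq> y"
  then have "{#x, y#} \<subseteq># V"
    using xy by (simp add: insert_subset_eq_iff in_diff_count)
  then obtain R where "V = {#x, y#} + R" by (metis subset_mset.le_iff_add)
  then obtain zs where zs: "V = mset (x # y # zs)" by (metis add_mset_add_single ex_mset
      mset.simps(2) union_mset_add_mset_left add.left_neutral)
  have cover: "(\<lambda>i. seq_sum G (mset (take i us))) ` {..<length us} = carrier G"
    if "V = mset us" for us
  proof (rule card_subset_eq[OF finite_carrier])
    show "(\<lambda>i. seq_sum G (mset (take i us))) ` {..<length us} \<subseteq> carrier G"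
      using partial_sum_closed V that by auto
    show "card ((\<lambda>i. seq_sum G (mset (take i us))) ` {..<length us}) = card (carrier G)"
      using partial_sums_inj[of us] V that by (simp add: card_image order_def)
  qed
  let ?p = "\<lambda>us i. seq_sum G (mset (take i us))"
  have xyG: "x \<in> carrier G" "y \<in> carrier G" using atom_support V xy by auto
  have "x \<in> ?p (y # x # zs) ` {..<length (y # x # zs)}"
    using cover[of "y # x # zs"] zs xyG by (simp add: add_mset_commute)
  then obtain i where i: "i < length (x # y # zs)" "x = ?p (y # x # zs) i" by auto
  have x1: "?p (x # y # zs) 1 = x" "?p (y # x # zs) 1 = y" using xyG seq_sum_single by auto
  have "i \<noteq> 1" using i x1 ne by auto
  then have "mset (take i (x # y # zs)) = mset (take i (y # x # zs))"
    by (cases i; cases "i - 1") (auto simp: add_mset_commute)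
  then have "?p (x # y # zs) i = ?p (x # y # zs) 1" using i(2) x1 by simp
  then have "i = 1"
    using inj_onD[OF partial_sums_inj[of "x # y # zs"], of i 1] V zs i(1) by simp
  with \<open>i \<noteq> 1\<close> show False by simp
qed

text \<open>\<open>h\<close> taken \<open>ord h\<close> times is a zero-sum sequence inside the atom, so it is the atom.\<close>

lemma replicate_atom_ord:
  assumes "replicate_mset k h \<in> atoms B"
  shows "ord h = k" "h \<in> carrier G"
proof -
  have k: "k > 0" using assms by (auto simp: atoms_B_iff intro: Nat.gr0I)
  then show h: "h \<in> carrier G" using atom_support[OF assms] by simp
  have "h [^] k = \<one>" using assms seq_sum_replicate[OF h] by (simp add: atoms_B_iff carrier_B)
  then have "ord h dvd k" using pow_eq_id[OF h] by simp
  then have le: "ord h \<le> k" using k by (simp add: dvd_imp_le)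
  have "ord h \<noteq> 0" using \<open>ord h dvd k\<close> k by auto
  have "replicate_mset (ord h) h \<in> carrier B"
    using h seq_sum_replicate[OF h, of "ord h"] by (auto simp: carrier_B)
  moreover have "replicate_mset (ord h) h \<subseteq># replicate_mset k h"
    using le by (simp add: subseteq_mset_def)
  ultimately have "replicate_mset (ord h) h = {#} \<or> replicate_mset (ord h) h = replicate_mset k h"
    using assms by (auto simp: atoms_B_iff)
  then have "size (replicate_mset (ord h) h) = 0 \<or>
      size (replicate_mset (ord h) h) = size (replicate_mset k h)"
    by (elim disjE) (simp_all only: size_empty simp_thms)
  then show "ord h = k" using \<open>ord h \<noteq> 0\<close> by (simp only: size_replicate_mset) simp
qed

lemma long_atom:
  assumes V: "V \<in> atoms B" "size V = order G"
  obtains h where "V = replicate_mset (order G) h" "ord h = order G" "h \<in> carrier G"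
proof -
  have "V \<noteq> {#}" using V by (auto simp: atoms_B_iff)
  then obtain h where h: "h \<in># V" by auto
  have "set_mset V = {h}"
    using h long_atom_terms_eq[OF V] by blast
  then have "V = replicate_mset (size V) h"
    by (metis set_mset_subset_singletonD subset_refl)
  then have "V = replicate_mset (order G) h" using V by simp
  then show ?thesis using replicate_atom_ord V that by metis
qed

lemma atom_one_iff: "V \<in> atoms B \<Longrightarrow> \<one> \<in># V \<longleftrightarrow> V = {#\<one>#}"
proof -
  assume V: "V \<in> atoms B"
  have "{#\<one>#} \<in> carrier B" by (simp add: carrier_B seq_sum_single)
  then show ?thesis using V by (auto simp: atoms_B_iff)
qed

lemma atom_size_ge:
  assumes "V \<in> atoms B" "V \<noteq> {#\<one>#}"
  shows "size V \<ge> 2"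
proof (rule ccontr)
  assume "\<not> size V \<ge> 2"
  moreover have "size V \<noteq> 0" using assms by (auto simp: atoms_B_iff)
  ultimately have "size V = 1" by linarith
  then obtain g where "V = {#g#}" by (metis size_1_singleton_mset)
  then show False using assms seq_sum_single[of g] by (auto simp: atoms_B_iff carrier_B)
qed

section \<open>The index of a sequence with respect to a generator\<close>

text \<open>The discrete logarithm to the base \<open>g\<close>, with values in \<open>{1..n}\<close> when \<open>g\<close> generates a group of
  order \<open>n\<close>; the neutral element gets the value \<open>n\<close>. Starting at one makes the weight below at least
  the length of a sequence.\<close>

definition dlog where "dlog g x = (LEAST k. 1 \<le> k \<and> g [^] (k::nat) = x)"

text \<open>\<open>weight g S\<close> divided by the group order is the index of \<open>S\<close>, commonly written \<open>\<parallel>S\<parallel>\<^sub>g\<close>. It is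
  additive, and it is an integer exactly for zero-sum sequences.\<close>

definition weight where "weight g S = (\<Sum>x\<in>#S. dlog g x)"

lemma dlog_pow:
  assumes g: "g \<in> carrier G" "ord g = order G" and k: "1 \<le> k" "k \<le> order G"
  shows "dlog g (g [^] k) = k"
proof -
  have "dlog g (g [^] k) \<le> k"
    unfolding dlog_def by (rule Least_le) (use k in simp)
  moreover have "1 \<le> dlog g (g [^] k) \<and> g [^] dlog g (g [^] k) = g [^] k"
    unfolding dlog_def by (rule LeastI[of _ k]) (use k in simp)
  moreover have "inj_on (\<lambda>x. g [^] x) {1..order G}"
    using ord_inj'[OF g(1)] g(2) by simp
  ultimately show ?thesis using k by (auto dest: inj_onD)
qed

lemma dlog_exists:
  assumes g: "g \<in> carrier G" "ord g = order G" and x: "x \<in> carrier G"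
  obtains k where "1 \<le> k" "k \<le> order G" "x = g [^] k"
proof -
  have "inj_on (\<lambda>x. g [^] x) {1..order G}"
    using ord_inj'[OF g(1)] g(2) by simp
  then have "card ((\<lambda>k. g [^] k) ` {1..order G}) = card (carrier G)"
    by (simp add: card_image order_def)
  moreover have "(\<lambda>k. g [^] k) ` {1..order G} \<subseteq> carrier G" using g by auto
  ultimately have "(\<lambda>k. g [^] k) ` {1..order G} = carrier G"
    using card_subset_eq[OF finite_carrier] by blast
  then show ?thesis using x that by (metis (no_types, lifting) atLeastAtMost_iff imageE)
qed

lemma dlog:
  assumes g: "g \<in> carrier G" "ord g = order G" and x: "x \<in> carrier G"
  shows "1 \<le> dlog g x" "dlog g x \<le> order G" "g [^] dlog g x = x"
  using dlog_exists[OF assms] dlog_pow[OF g] by metis+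

lemma weight_union: "weight g (S + T) = weight g S + weight g T"
  by (simp add: weight_def)

lemma pow_weight:
  assumes g: "g \<in> carrier G" "ord g = order G" and S: "set_mset S \<subseteq> carrier G"
  shows "g [^] weight g S = seq_sum G S"
  using S
proof (induction S)
  case (add x S)
  then have x: "x \<in> carrier G" by simp
  have "seq_sum G (add_mset x S) = x \<otimes> seq_sum G S"
    using seq_sum_union[of "{#x#}" S] seq_sum_single[OF x] add.prems by simp
  also have "\<dots> = g [^] (dlog g x + weight g S)"
    using add dlog(3)[OF g x] g(1) by (simp flip: nat_pow_mult)
  finally show ?case by (simp add: weight_def)
qed (simp add: weight_def)

lemma zero_sum_iff_dvd_weight:
  assumes g: "g \<in> carrier G" "ord g = order G" and S: "set_mset S \<subseteq> carrier G"
  shows "S \<in> carrier B \<longleftrightarrow> order G dvd weight g S"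
  using pow_weight[OF assms] pow_eq_id[OF g(1), of "weight g S"] g(2) S by (simp add: carrier_B)

lemma size_le_weight:
  assumes g: "g \<in> carrier G" "ord g = order G" and S: "set_mset S \<subseteq> carrier G"
  shows "size S \<le> weight g S"
  using S
proof (induction S)
  case (add x S)
  then show ?case using dlog(1)[OF g, of x] by (simp add: weight_def)
qed simp

text \<open>A zero-sum sequence of index one cannot be split, since every nonempty zero-sum sequence has a
  positive integral index. This one criterion provides all the atoms that are needed below.\<close>

lemma weight_eq_order_atom:
  assumes g: "g \<in> carrier G" "ord g = order G"
    and V: "set_mset V \<subseteq> carrier G" "weight g V = order G"
  shows "V \<in> atoms B"
  unfolding atoms_B_iff
proof (intro conjI ballI impI)
  show "V \<in> carrier B" using zero_sum_iff_dvd_weight[OF g V(1)] V(2) by simp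
  have "order G > 0" using finite_carrier order_gt_0_iff_finite by blast
  then show "V \<noteq> {#}" using V(2) by (auto simp: weight_def)
  fix W assume W: "W \<in> carrier B" "W \<subseteq># V"
  then obtain T where T: "V = W + T" by (metis subset_mset.le_iff_add)
  have WG: "set_mset W \<subseteq> carrier G" and TG: "set_mset T \<subseteq> carrier G" using V(1) T by auto
  show "W = {#} \<or> W = V"
  proof (cases "W = {#}")
    case False
    then have "weight g W > 0" using size_le_weight[OF g WG] by (metis gr0I le_zero_eq size_eq_0_iff_empty)
    then have "weight g W \<ge> order G"
      using zero_sum_iff_dvd_weight[OF g WG] W(1) by (simp add: dvd_imp_le)
    then have "weight g T = 0" using V(2) T by (simp add: weight_union)
    then show ?thesis using size_le_weight[OF g TG] T by simp
  qed simp
qed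

lemma dlog_self:
  assumes "g \<in> carrier G" "ord g = order G"
  shows "dlog g g = 1"
proof -
  have "order G > 0" using finite_carrier order_gt_0_iff_finite by blast
  then show ?thesis using dlog_pow[OF assms, of 1] assms by simp
qed

lemma weight_replicate: "weight g (replicate_mset k x) = k * dlog g x"
  by (simp add: weight_def)

lemma power_atom:
  assumes g: "g \<in> carrier G" "ord g = order G"
  shows "replicate_mset (order G) g \<in> atoms B"
  using g by (intro weight_eq_order_atom[OF g])
    (auto simp: weight_replicate dlog_self split: if_splits)

text \<open>Completing each term \<open>x\<close> by \<open>n - dlog g x\<close> copies of \<open>g\<close> gives a sequence of index one,
  hence an atom.\<close>

lemma size_mem_length_set_padded:
  assumes g: "g \<in> carrier G" "ord g = order G" and S: "set_mset S \<subseteq> carrier G"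
  shows "size S \<in> length_set B (S + replicate_mset (\<Sum>x\<in>#S. order G - dlog g x) g)"
  using S
proof (induction S)
  case empty
  then show ?case by (simp add: length_set_empty)
next
  case (add x S)
  then have x: "x \<in> carrier G" by simp
  let ?P = "add_mset x (replicate_mset (order G - dlog g x) g)"
  have "weight g ?P = dlog g x + weight g (replicate_mset (order G - dlog g x) g)"
    by (simp add: weight_def)
  then have "weight g ?P = order G"
    using dlog(2)[OF g x] by (simp add: weight_replicate dlog_self[OF g])
  then have "?P \<in> atoms B" using x g by (intro weight_eq_order_atom[OF g]) auto
  then have "1 \<in> length_set B ?P" by (auto simp: mem_length_set_B intro!: exI[of _ "[?P]"])
  moreover have "size S \<in> length_set B (S + replicate_mset (\<Sum>x\<in>#S. order G - dlog g x) g)"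
    using add by simp
  ultimately have "1 + size S \<in> length_set B
      (?P + (S + replicate_mset (\<Sum>x\<in>#S. order G - dlog g x) g))"
    by (rule length_set_add)
  moreover have "?P + (S + replicate_mset (\<Sum>x\<in>#S. order G - dlog g x) g) =
      add_mset x S + replicate_mset (\<Sum>x\<in>#add_mset x S. order G - dlog g x) g"
    by (simp add: multiset_eq_iff)
  ultimately show ?case by (metis plus_1_eq_Suc size_add_mset)
qed

lemma padding_size:
  assumes g: "g \<in> carrier G" "ord g = order G" and S: "set_mset S \<subseteq> carrier G"
  shows "(\<Sum>x\<in>#S. order G - dlog g x) + weight g S = order G * size S"
  using S
proof (induction S)
  case (add x S)
  then show ?case using dlog(2)[OF g, of x] by (simp add: weight_def)
qed (simp add: weight_def)

text \<open>Padding an atom \<open>V\<close> with \<open>size V - q\<close> copies of \<open>g\<^sup>n\<close>, where \<open>q\<close> is the index of \<open>V\<close>, gives a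
  sequence which is a product of \<open>1 + (size V - q)\<close> atoms by construction and of \<open>size V\<close> atoms by the
  previous padding lemma. If the padded sequence divides \<open>A\<close>, then \<open>A\<close> has two lengths that differ
  by \<open>q - 1\<close>. The hypothesis provides room for \<open>n\<close> times \<open>size V\<close> copies of \<open>g\<close>.\<close>

lemma atom_index_cong:
  assumes g: "g \<in> carrier G" "ord g = order G"
    and A: "A \<in> carrier B" and V: "V \<in> atoms B"
    and sub: "V + replicate_mset (order G * size V) g \<subseteq># A"
    and dv: "\<And>x y. x \<in> length_set B A \<Longrightarrow> y \<in> length_set B A \<Longrightarrow> int d dvd int x - int y"
  shows "int d dvd int (weight g V div order G) - 1"
proof -
  have VG: "set_mset V \<subseteq> carrier G" and VB: "V \<in> carrier B"
    using V atom_support atom_carrier by auto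
  define r where "r = (\<Sum>x\<in>#V. order G - dlog g x)"
  define q where "q = weight g V div order G"
  have q: "weight g V = order G * q"
    using zero_sum_iff_dvd_weight[OF g VG] VB by (simp add: q_def)
  have n0: "order G > 0" using finite_carrier order_gt_0_iff_finite by blast
  have rq: "r + order G * q = order G * size V"
    using padding_size[OF g VG] q by (simp add: r_def)
  then have "order G * q \<le> order G * size V" by linarith
  then have qle: "q \<le> size V" using n0 by simp
  have r: "r = (size V - q) * order G"
    using rq by (simp add: diff_mult_distrib2 mult.commute)
  have "r \<le> order G * size V" using rq by simp
  then have "V + replicate_mset r g \<subseteq># V + replicate_mset (order G * size V) g"
    by (simp add: subseteq_mset_def)
  then have "V + replicate_mset r g \<subseteq># A" using sub subset_mset.order_trans by blast
  then obtain W where W: "A = (V + replicate_mset r g) + W" by (metis subset_mset.le_iff_add)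
  have repl: "replicate_mset r g = repeat_mset (size V - q) (replicate_mset (order G) g)"
    by (simp add: r multiset_eq_iff)
  have "1 \<in> length_set B (replicate_mset (order G) g)"
    using power_atom[OF g] by (auto simp: mem_length_set_B intro!: exI[of _ "[replicate_mset (order G) g]"])
  from length_set_repeat[OF this, of "size V - q"]
  have "size V - q \<in> length_set B (replicate_mset r g)" by (simp add: repl)
  moreover have "1 \<in> length_set B V"
    using V by (auto simp: mem_length_set_B intro!: exI[of _ "[V]"])
  ultimately have short: "1 + (size V - q) \<in> length_set B (V + replicate_mset r g)"
    by (intro length_set_add)
  have long: "size V \<in> length_set B (V + replicate_mset r g)"
    using size_mem_length_set_padded[OF g VG] by (simp add: r_def)
  have "V + replicate_mset r g \<in> carrier B"
    using long sum_list_atoms_closed by (auto simp: mem_length_set_B)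
  then have "W \<in> carrier B" using A W carrier_B_cancel by metis
  then obtain m where m: "m \<in> length_set B W" using length_set_nonempty by blast
  have "int d dvd int (size V + m) - int (1 + (size V - q) + m)"
    using dv length_set_add[OF long m] length_set_add[OF short m] W by blast
  then show ?thesis using qle by (simp add: q_def of_nat_diff)
qed

text \<open>If every atom over \<open>X\<close> has index one modulo \<open>d\<close>, then by additivity the number of atoms in any
  factorization over \<open>X\<close> is determined modulo \<open>d\<close> by the index of the product.\<close>

lemma length_cong_index:
  assumes g: "g \<in> carrier G" "ord g = order G"
    and atoms: "\<And>V. V \<in> atoms B \<Longrightarrow> set_mset V \<subseteq> X \<Longrightarrow> int d dvd int (weight g V div order G) - 1"
    and C: "set_mset C \<subseteq> X" and x: "x \<in> length_set B C"
  shows "int d dvd int (weight g C div order G) - int x"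
proof -
  obtain us where us: "length us = x" "set us \<subseteq> atoms B" "C = sum_list us"
    using x by (auto simp: mem_length_set_B)
  have "int d dvd int (weight g (sum_list us) div order G) - int (length us)"
    if "set us \<subseteq> atoms B" "set_mset (sum_list us) \<subseteq> X"
    using that
  proof (induction us)
    case (Cons u us)
    have "order G dvd weight g u" "order G dvd weight g (sum_list us)"
      using zero_sum_iff_dvd_weight[OF g] Cons.prems atom_carrier[of u] sum_list_atoms_closed[of us]
      by (auto simp: carrier_B)
    then have eq: "weight g (sum_list (u # us)) div order G =
        weight g u div order G + weight g (sum_list us) div order G"
      by (simp add: weight_union div_add)
    have "int d dvd (int (weight g u div order G) - 1) +
        (int (weight g (sum_list us) div order G) - int (length us))"
      using Cons atoms by (intro dvd_add) auto
    also have "\<dots> = int (weight g (sum_list (u # us)) div order G) - int (length (u # us))"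
      using eq by simp
    finally show ?case .
  qed (simp add: weight_def)
  then show ?thesis using us C by simp
qed

section \<open>Elasticity\<close>

text \<open>The neutral element of \<open>G\<close> is an atom of length one. It is the only atom of length below two, and
  so its multiplicity has to be added in the following two estimates, which bound the number of
  atoms from above and from below by the length of the sequence.\<close>

lemma size_add_count_one_ge:
  assumes "set us \<subseteq> atoms B"
  shows "2 * length us \<le> size (sum_list us) + count (sum_list us) \<one>"
  using assms
proof (induction us)
  case (Cons u us)
  have "2 \<le> size u + count u \<one>"
    using Cons.prems atom_size_ge[of u] by (cases "u = {#\<one>#}") auto
  then show ?case using Cons by simp
qed simp

lemma size_add_count_one_le:
  assumes "set us \<subseteq> atoms B"
  shows "size (sum_list us) + (order G - 1) * count (sum_list us) \<one> \<le> order G * length us"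
  using assms
proof (induction us)
  case (Cons u us)
  have n0: "order G > 0" using finite_carrier order_gt_0_iff_finite by blast
  have "size u + (order G - 1) * count u \<one> \<le> order G"
  proof (cases "u = {#\<one>#}")
    case False
    then have "count u \<one> = 0" using Cons.prems atom_one_iff[of u] by (simp add: not_in_iff)
    then show ?thesis using atom_size_le[of u] Cons.prems by simp
  qed (use n0 in simp)
  moreover have "size (sum_list us) + (order G - 1) * count (sum_list us) \<one> \<le> order G * length us"
    using Cons by simp
  ultimately show ?case by (simp add: algebra_simps)
qed simp

lemma all_long_if_size_max:
  assumes "set us \<subseteq> atoms B" "size (sum_list us) = order G * length us" "u \<in> set us"
  shows "size u = order G"
  using assms
proof (induction us)
  case (Cons v us)
  have "size v \<le> order G" using atom_size_le Cons.prems by simp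
  moreover have "size (sum_list us) \<le> order G * length us"
    using size_add_count_one_le[of us] Cons.prems by simp
  ultimately have "size v = order G" "size (sum_list us) = order G * length us"
    using Cons.prems(2) by auto
  then show ?case using Cons by auto
qed simp

text \<open>This is the bound \<open>\<rho>(L) \<le> n / 2\<close>: a sequence without neutral elements has at least
  \<open>size A / n\<close> and at most \<open>size A / 2\<close> factors, and each neutral element adds one to both counts,
  which cannot increase their quotient.\<close>

lemma double_length_le:
  assumes "order G \<ge> 2" "k \<in> length_set B A" "l \<in> length_set B A"
  shows "2 * l \<le> order G * k"
proof -
  have "size A + (order G - 1) * count A \<one> \<le> order G * k"
    using size_add_count_one_le assms(2) by (auto simp: mem_length_set_B)
  moreover have "2 * l \<le> size A + count A \<one>"
    using size_add_count_one_ge assms(3) by (auto simp: mem_length_set_B)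
  moreover have "1 * count A \<one> \<le> (order G - 1) * count A \<one>"
    using assms(1) by (intro mult_right_mono) auto
  ultimately show ?thesis by linarith
qed

text \<open>Equality in the bound excludes the neutral element and forces all atoms of the shorter
  factorization to have length \<open>n\<close>; such atoms are \<open>n\<close>-th powers of generators.\<close>

lemma extremal_support:
  assumes n3: "order G \<ge> 3" and kl: "k \<in> length_set B A" "l \<in> length_set B A" "2 * l = order G * k"
    and h: "h \<in># A"
  shows "h \<in> carrier G" "ord h = order G" "order G \<le> count A h"
proof -
  obtain us where us: "length us = k" "set us \<subseteq> atoms B" "A = sum_list us"
    using kl(1) by (auto simp: mem_length_set_B)
  have up: "size A + (order G - 1) * count A \<one> \<le> order G * k"
    using size_add_count_one_le us by auto
  have lo: "2 * l \<le> size A + count A \<one>"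
    using size_add_count_one_ge kl(2) by (auto simp: mem_length_set_B)
  have "2 * count A \<one> \<le> (order G - 1) * count A \<one>"
    using n3 by (intro mult_right_mono) auto
  then have "count A \<one> = 0" using up lo kl(3) by linarith
  then have "size (sum_list us) = order G * length us" using up lo kl(3) us by simp
  then have long: "size u = order G" if "u \<in> set us" for u
    using all_long_if_size_max us(2) that by blast
  obtain u where u: "u \<in> set us" "h \<in># u"
    using h us(3) by (induction us arbitrary: A) auto
  then obtain h' where h': "u = replicate_mset (order G) h'" "ord h' = order G" "h' \<in> carrier G"
    using long_atom[of u] long us(2) by blast
  have hh: "h = h'" using u(2) h'(1) by (simp split: if_splits)
  then show "h \<in> carrier G" "ord h = order G" using h' by auto
  obtain ps qs where "us = ps @ u # qs" using u(1) by (meson split_list)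
  then have "count u h \<le> count A h" using us(3) by simp
  then show "order G \<le> count A h" using h' hh by simp
qed

section \<open>Sequences of maximal elasticity\<close>


lemma length_set_repeat_mix:
  assumes "x \<in> length_set B C" "y \<in> length_set B C" "i \<le> k"
  shows "i * y + (k - i) * x \<in> length_set B (repeat_mset k C)"
proof -
  have "repeat_mset k C = repeat_mset i C + repeat_mset (k - i) C"
    using assms(3) by (simp add: multiset_eq_iff flip: add_mult_distrib)
  then show ?thesis using length_set_add length_set_repeat assms by metis
qed

lemma set_mset_repeat_subset: "set_mset (repeat_mset m A) \<subseteq> set_mset A"
  by (auto simp flip: count_greater_zero_iff)

lemma repeat_mset_1: "repeat_mset 1 A = A"
  by (simp add: multiset_eq_iff)

lemma mem_Delta_on_powers:
  "e \<in> Delta_on B (powers B A) \<longleftrightarrow> (\<exists>m. e \<in> distances (length_set B (repeat_mset m A)))"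
  by (auto simp: Delta_on_def powers_def pow_B)

text \<open>The minimum \<open>d\<close> of the distances in powers of \<open>A\<close> is their greatest common divisor. If \<open>d\<close> did not
  divide a distance \<open>e = q * d + r\<close>, then a power of \<open>A\<close> having \<open>{0, d, ..., (q + 1) * d} + {0, e}\<close>,
  up to a shift, among its lengths would have two lengths that differ by \<open>r < d\<close>, and hence a distance
  below \<open>d\<close>.\<close>

lemma distances_dvd_Inf:
  assumes d: "d = Inf (Delta_on B (powers B A))" "d \<in> Delta_on B (powers B A)"
    and e: "e \<in> Delta_on B (powers B A)"
  shows "d dvd e"
proof (rule ccontr)
  assume nd: "\<not> d dvd e"
  obtain m0 where "d \<in> distances (length_set B (repeat_mset m0 A))"
    using d(2) mem_Delta_on_powers by blast
  then obtain x where x: "x \<in> length_set B (repeat_mset m0 A)"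
    "x + d \<in> length_set B (repeat_mset m0 A)" "d > 0" by (rule mem_distancesE)
  obtain m1 where "e \<in> distances (length_set B (repeat_mset m1 A))"
    using e mem_Delta_on_powers by blast
  then obtain y where y: "y \<in> length_set B (repeat_mset m1 A)"
    "y + e \<in> length_set B (repeat_mset m1 A)" by (rule mem_distancesE)
  define q where "q = e div d"
  define C where "C = repeat_mset (Suc q) (repeat_mset m0 A) + repeat_mset m1 A"
  have C: "C = repeat_mset (Suc q * m0 + m1) A"
    by (simp add: C_def multiset_eq_iff algebra_simps)
  \<comment> \<open>Both are lengths of \<open>C\<close>, written as the mixed sums from which they arise; they differ by
    \<open>e mod d\<close>.\<close>
  let ?u = "(q * (x + d) + (Suc q - q) * x) + y"
  let ?w = "(0 * (x + d) + (Suc q - 0) * x) + (y + e)"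
  have u: "?u \<in> length_set B C"
    unfolding C_def using x y by (intro length_set_add length_set_repeat_mix) auto
  have w: "?w \<in> length_set B C"
    unfolding C_def using x y by (intro length_set_add length_set_repeat_mix) auto
  have "e = q * d + e mod d" by (simp add: q_def)
  moreover have "0 < e mod d" "e mod d < d" using nd x(3) by (auto simp: dvd_eq_mod_eq_0)
  ultimately have "?u < ?w" "?w < ?u + d" by (simp_all add: algebra_simps)
  then obtain z where z: "z \<le> ?w" "z - ?u \<in> distances (length_set B C)"
    using distances_obtain[OF u w] by metis
  have "z - ?u \<in> Delta_on B (powers B A)" using z(2) C mem_Delta_on_powers by blast
  then have "d \<le> z - ?u" using d(1) wellorder_Inf_le1 by blast
  then show False using z(1) \<open>?w < ?u + d\<close> x(3) by linarith
qed

lemma Inf_Delta_on_powers: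
  assumes "d \<in> distances (length_set B A)"
    and "\<And>m x y. x \<in> length_set B (repeat_mset m A) \<Longrightarrow> y \<in> length_set B (repeat_mset m A) \<Longrightarrow>
      int d dvd int x - int y"
  shows "Inf (Delta_on B (powers B A)) = d" "Delta_on B (powers B A) \<noteq> {}"
proof -
  have mem: "d \<in> Delta_on B (powers B A)"
    using assms(1) mem_Delta_on_powers[of d A] by (metis repeat_mset_1)
  then show "Delta_on B (powers B A) \<noteq> {}" by auto
  have "d dvd e \<and> e > 0" if e: "e \<in> Delta_on B (powers B A)" for e
  proof -
    obtain m where "e \<in> distances (length_set B (repeat_mset m A))"
      using e mem_Delta_on_powers by blast
    then obtain x where x: "x \<in> length_set B (repeat_mset m A)"
      "x + e \<in> length_set B (repeat_mset m A)" "e > 0" by (rule mem_distancesE)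
    then have "int d dvd int (x + e) - int x" using assms(2) by blast
    then show ?thesis using x(3) by simp
  qed
  with mem show "Inf (Delta_on B (powers B A)) = d" by (rule Inf_multiples)
qed

lemma exists_frequent_element:
  assumes "set_mset A \<subseteq> carrier G" "size A > order G * N"
  obtains g where "g \<in># A" "count A g \<ge> N"
proof -
  have "\<exists>g\<in>#A. count A g \<ge> N"
  proof (rule ccontr)
    assume "\<not> ?thesis"
    then have "size A \<le> (\<Sum>g\<in>set_mset A. N)"
      unfolding size_multiset_overloaded_eq by (intro sum_mono) auto
    also have "\<dots> \<le> order G * N"
      using card_mono[OF finite_carrier assms(1)] by (simp add: order_def)
    finally show False using assms(2) by simp
  qed
  then show ?thesis using that by blast
qed

lemma set_elasticity_empty_seq: "set_elasticity (length_set B {#}) = 1"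
  by (simp add: length_set_def Units_B set_elasticity_def)

end

locale cyclic_ge3 = finite_comm_group +
  assumes order_ge3: "order G \<ge> 3"
    and generator: "\<exists>g \<in> carrier G. ord g = order G"
begin

text \<open>A sequence has maximal elasticity as soon as some two of its lengths have quotient \<open>n / 2\<close>, as
  these must be the extreme ones.\<close>

lemma set_elasticity_le_iff:
  assumes "A \<in> carrier B" "A \<noteq> {#}"
  shows "set_elasticity (length_set B A) \<le> ereal (real (order G) / 2)"
    and "set_elasticity (length_set B A) = ereal (real (order G) / 2) \<longleftrightarrow>
      (\<exists>k\<in>length_set B A. \<exists>l\<in>length_set B A. 2 * l = order G * k)"
proof -
  let ?L = "length_set B A"
  have L: "finite ?L" "?L \<noteq> {}" "0 \<notin> ?L"
    using finite_length_set length_set_nonempty assms zero_notin_length_set by auto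
  have mem: "Max ?L \<in> ?L" "Min ?L \<in> ?L" using L by auto
  have pos: "Min ?L > 0" using mem(2) L(3) by (metis gr0I)
  have le: "2 * Max ?L \<le> order G * Min ?L"
    using double_length_le[OF _ mem(2,1)] order_ge3 by simp
  then have le': "2 * real (Max ?L) \<le> real (order G) * real (Min ?L)"
    unfolding of_nat_le_iff[where 'a = real, symmetric] by simp
  note eq = set_elasticity_finite[OF L]
  show "set_elasticity ?L \<le> ereal (real (order G) / 2)"
    using le' pos by (simp add: eq field_simps)
  have "set_elasticity ?L = ereal (real (order G) / 2) \<longleftrightarrow>
      2 * real (Max ?L) = real (order G) * real (Min ?L)"
    using pos by (simp add: eq field_simps)
  also have "\<dots> \<longleftrightarrow> 2 * Max ?L = order G * Min ?L"
    unfolding of_nat_eq_iff[where 'a = real, symmetric] by simp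
  also have "\<dots> \<longleftrightarrow> (\<exists>k\<in>?L. \<exists>l\<in>?L. 2 * l = order G * k)"
  proof
    assume "\<exists>k\<in>?L. \<exists>l\<in>?L. 2 * l = order G * k"
    then obtain k l where kl: "k \<in> ?L" "l \<in> ?L" "2 * l = order G * k" by auto
    then have "order G * Min ?L \<le> order G * k" "l \<le> Max ?L" using L by simp_all
    then show "2 * Max ?L = order G * Min ?L" using kl(3) le by linarith
  qed (use mem in blast)
  finally show "set_elasticity ?L = ereal (real (order G) / 2) \<longleftrightarrow>
      (\<exists>k\<in>?L. \<exists>l\<in>?L. 2 * l = order G * k)" .
qed

text \<open>The sequence \<open>g\<^sup>n (-g)\<^sup>n\<close> in additive notation. Its factorizations \<open>g\<^sup>n \<cdot> (-g)\<^sup>n\<close> and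
  \<open>(g (-g))\<^sup>n\<close> show that the elasticity \<open>n / 2\<close> is attained.\<close>

definition twin where "twin g = replicate_mset (order G) g + replicate_mset (order G) (inv g)"

lemma inv_generator:
  assumes g: "g \<in> carrier G" "ord g = order G"
  shows "dlog g (inv g) = order G - 1" "inv g \<noteq> g"
proof -
  have "g [^] (order G - 1) \<otimes> g = g [^] (Suc (order G - 1))" by simp
  also have "\<dots> = \<one>" using pow_eq_id[OF g(1), of "order G"] g(2) order_ge3 by simp
  finally have "inv g = g [^] (order G - 1)" using g(1) by (intro inv_equality) auto
  then show "dlog g (inv g) = order G - 1"
    using dlog_pow[OF g, of "order G - 1"] order_ge3 by simp
  then show "inv g \<noteq> g" using dlog_self[OF g] order_ge3 by auto
qed

lemma twin_lengths:
  assumes g: "g \<in> carrier G" "ord g = order G"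
  shows "2 \<in> length_set B (twin g)" "order G \<in> length_set B (twin g)"
proof -
  have "replicate_mset (order G) g \<in> atoms B" "replicate_mset (order G) (inv g) \<in> atoms B"
    using power_atom[OF g] power_atom[of "inv g"] g by simp_all
  then show "2 \<in> length_set B (twin g)"
    by (auto simp: mem_length_set_B twin_def
        intro!: exI[of _ "[replicate_mset (order G) g, replicate_mset (order G) (inv g)]"])
  have "weight g {#g, inv g#} = order G"
    using dlog_self[OF g] inv_generator[OF g] order_ge3 by (simp add: weight_def)
  then have "{#g, inv g#} \<in> atoms B" using g by (intro weight_eq_order_atom[OF g]) auto
  then have "1 \<in> length_set B {#g, inv g#}"
    by (auto simp: mem_length_set_B intro!: exI[of _ "[{#g, inv g#}]"])
  from length_set_repeat[OF this, of "order G"]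
  show "order G \<in> length_set B (twin g)"
    by (simp add: twin_def repeat_mset_distrib_add_mset)
qed

lemma twin_carrier:
  assumes g: "g \<in> carrier G" "ord g = order G"
  shows "twin g \<in> carrier B" "twin g \<noteq> {#}"
  using twin_lengths[OF g] sum_list_atoms_closed order_ge3 by (auto simp: mem_length_set_B twin_def)

lemma elasticity_B: "elasticity B = ereal (real (order G) / 2)"
proof (rule antisym)
  have "set_elasticity (length_set B A) \<le> ereal (real (order G) / 2)" if "A \<in> carrier B" for A
    using set_elasticity_le_iff(1)[OF that] set_elasticity_empty_seq order_ge3
    by (cases "A = {#}") (auto simp: one_ereal_def)
  then show "elasticity B \<le> ereal (real (order G) / 2)"
    unfolding elasticity_def length_sets_def by (intro SUP_least) auto
  obtain g where g: "g \<in> carrier G" "ord g = order G" using generator by auto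
  have "set_elasticity (length_set B (twin g)) = ereal (real (order G) / 2)"
    unfolding set_elasticity_le_iff(2)[OF twin_carrier[OF g]] using twin_lengths[OF g]
    by (intro bexI[of _ 2] bexI[of _ "order G"]) simp_all
  then show "ereal (real (order G) / 2) \<le> elasticity B"
    unfolding elasticity_def length_sets_def using twin_carrier[OF g]
    by (metis SUP_upper imageI)
qed

lemma extremal_iff:
  assumes "A \<in> carrier B"
  shows "set_elasticity (length_set B A) = elasticity B \<longleftrightarrow>
    A \<noteq> {#} \<and> (\<exists>k\<in>length_set B A. \<exists>l\<in>length_set B A. 2 * l = order G * k)"
  using set_elasticity_le_iff(2)[OF assms] set_elasticity_empty_seq order_ge3
  by (cases "A = {#}") (auto simp: one_ereal_def elasticity_B)

section \<open>The two sets of differences\<close>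

text \<open>If two lengths of some power of \<open>A\<close> differ by \<open>d\<close>, then the \<open>k\<close>-th power of that power has a
  progression of length \<open>k\<close> among its lengths. All its lengths lie in one residue class modulo \<open>d\<close>,
  and powers inherit maximal elasticity.\<close>

lemma Delta_rho_star_subset: "Delta_rho_star B \<subseteq> Delta_rho B"
proof
  fix d assume "d \<in> Delta_rho_star B"
  then obtain A where d: "d = Inf (Delta_on B (powers B A))" and A: "A \<in> carrier B"
    and el: "set_elasticity (length_set B A) = elasticity B"
    and ne: "Delta_on B (powers B A) \<noteq> {}"
    unfolding Delta_rho_star_def by blast
  have dD: "d \<in> Delta_on B (powers B A)" using d ne by (simp add: Inf_nat_def1)
  then obtain m where m: "d \<in> distances (length_set B (repeat_mset m A))"
    using mem_Delta_on_powers by blast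
  then obtain x where x: "x \<in> length_set B (repeat_mset m A)"
    "x + d \<in> length_set B (repeat_mset m A)" "d > 0" by (rule mem_distancesE)
  have m0: "m > 0"
  proof (rule gr0I)
    assume "m = 0"
    then show False using x length_le_size[of "x + d" "{#}"] by simp
  qed
  obtain k0 l0 where kl: "k0 \<in> length_set B A" "l0 \<in> length_set B A" "2 * l0 = order G * k0"
    and A0: "A \<noteq> {#}"
    using el extremal_iff[OF A] by blast
  have "\<exists>L \<in> length_sets B. \<exists>l\<ge>k. is_AAP (int ` L) d l \<and> set_elasticity L = elasticity B"
    if k: "k \<ge> 1" for k
  proof -
    define C where "C = repeat_mset (k * m) A"
    have C': "C = repeat_mset k (repeat_mset m A)" by (simp add: C_def multiset_eq_iff)
    have CB: "C \<in> carrier B"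
      using length_set_repeat[OF kl(1), of "k * m"] sum_list_atoms_closed
      unfolding C_def mem_length_set_B by metis
    have "C \<noteq> {#}"
    proof -
      obtain h where "h \<in># A" using A0 by auto
      then have "count C h > 0" using k m0 by (simp add: C_def)
      then show ?thesis by auto
    qed
    moreover have "2 * (k * m * l0) = order G * (k * m * k0)" using kl(3) by simp
    ultimately have elC: "set_elasticity (length_set B C) = elasticity B"
      using extremal_iff[OF CB] length_set_repeat[OF kl(1), of "k * m"]
        length_set_repeat[OF kl(2), of "k * m"] unfolding C_def by blast
    have "k * x + i * d \<in> length_set B C" if "i \<le> k" for i
    proof -
      have "i * (x + d) + (k - i) * x = k * x + i * d"
        using that by (simp add: algebra_simps diff_mult_distrib)
      then show ?thesis using length_set_repeat_mix[OF x(1,2) that] C' by simp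
    qed
    moreover have "int d dvd int z - int (k * x)" if "z \<in> length_set B C" for z
    proof (rule dvd_diff_if_dvd_distances[of "length_set B C"])
      show "d dvd e" if "e \<in> distances (length_set B C)" for e
        using that distances_dvd_Inf[OF d dD] mem_Delta_on_powers C_def by blast
      show "k * x \<in> length_set B C" using length_set_repeat[OF x(1)] C' by simp
    qed (rule that)
    ultimately have "is_AAP (int ` length_set B C) d k"
      using is_AAP_image_int_iff[OF finite_length_set] x(3) by (metis Suc_leI One_nat_def)
    then show ?thesis using elC CB unfolding length_sets_def by blast
  qed
  then show "d \<in> Delta_rho B" using x(3) by (simp add: Delta_rho_def)
qed

text \<open>A long progression forces \<open>A\<close> to be long, so that one of its terms \<open>g\<close> occurs very
  often. All other elements of the support occur at least \<open>n\<close> times, which is as often as they can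
  occur in an atom. Hence every atom over the support of \<open>A\<close>, together with its padding by \<open>g\<close>,
  divides \<open>A\<close> itself, and its index is one modulo \<open>d\<close>. The lengths of each power of \<open>A\<close> are then
  congruent modulo \<open>d\<close>, while \<open>d\<close> is a distance of \<open>A\<close>.\<close>

lemma Delta_rho_subset: "Delta_rho B \<subseteq> Delta_rho_star B"
proof
  fix d assume d: "d \<in> Delta_rho B"
  let ?n = "order G"
  \<comment> \<open>An atom contains at most \<open>n\<close> copies of \<open>g\<close>, and its padding fits into \<open>n * n\<close> further ones.\<close>
  define N where "N = ?n + ?n * ?n"
  have "\<exists>L \<in> length_sets B. \<exists>l\<ge>Suc (?n * N). is_AAP (int ` L) d l \<and> set_elasticity L = elasticity B"
    using d by (simp add: Delta_rho_def)
  then obtain A l where A: "A \<in> carrier B" and l: "l \<ge> Suc (?n * N)"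
    and AAP: "is_AAP (int ` length_set B A) d l"
    and el: "set_elasticity (length_set B A) = elasticity B"
    unfolding length_sets_def by blast
  obtain y where d1: "d \<ge> 1" and y: "\<And>i. i \<le> l \<Longrightarrow> y + i * d \<in> length_set B A"
    and dy: "\<And>x. x \<in> length_set B A \<Longrightarrow> int d dvd int x - int y"
    using AAP is_AAP_image_int_iff[OF finite_length_set] by blast
  have dv: "int d dvd int x - int x'" if "x \<in> length_set B A" "x' \<in> length_set B A" for x x'
    using dvd_diff[OF dy[OF that(1)] dy[OF that(2)]] by simp
  obtain k0 l0 where kl: "k0 \<in> length_set B A" "l0 \<in> length_set B A" "2 * l0 = ?n * k0"
    using el extremal_iff[OF A] by blast
  note supp = extremal_support[OF order_ge3 kl]
  have "l * 1 \<le> l * d" using d1 by (intro mult_left_mono) auto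
  also have "l * d \<le> size A" using length_le_size[OF y[of l]] by simp
  finally have "size A > ?n * N" using l by simp
  moreover have "set_mset A \<subseteq> carrier G" using supp(1) by auto
  ultimately obtain g where gA: "g \<in># A" "count A g \<ge> N" using exists_frequent_element by metis
  have g: "g \<in> carrier G" "ord g = ?n" using supp gA by auto
  have atoms: "int d dvd int (weight g V div ?n) - 1" if V: "V \<in> atoms B" "set_mset V \<subseteq> set_mset A" for V
  proof (rule atom_index_cong[OF g A V(1) _ dv])
    have sz: "size V \<le> ?n" using atom_size_le V by simp
    have "count V h + count (replicate_mset (?n * size V) g) h \<le> count A h" for h
    proof (cases "h = g")
      case True
      have "count V g \<le> ?n" using sz count_le_size[of V] by (meson le_trans)
      moreover have "?n * size V \<le> ?n * ?n" using sz by simp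
      ultimately have "count V g + ?n * size V \<le> N" unfolding N_def by (rule add_mono)
      then show ?thesis using True gA(2) by simp
    next
      case False
      show ?thesis
      proof (cases "h \<in># V")
        case True
        then have "?n \<le> count A h" using supp(3) V(2) by auto
        moreover have "count V h \<le> ?n" using sz count_le_size[of V] by (meson le_trans)
        ultimately show ?thesis using False by simp
      next
        case False
        then show ?thesis using \<open>h \<noteq> g\<close> by (simp add: not_in_iff)
      qed
    qed
    then show "V + replicate_mset (?n * size V) g \<subseteq># A" by (simp add: subseteq_mset_def)
  qed
  have cong: "int d dvd int x - int x'"
    if "x \<in> length_set B (repeat_mset m A)" "x' \<in> length_set B (repeat_mset m A)" for m x x'
  proof -
    have sub: "set_mset (repeat_mset m A) \<subseteq> set_mset A" by (rule set_mset_repeat_subset)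
    show ?thesis
      using dvd_diff[OF length_cong_index[OF g atoms sub that(2)] length_cong_index[OF g atoms sub that(1)]]
      by simp
  qed
  have dist: "d \<in> distances (length_set B A)"
  proof -
    have "y \<in> length_set B A" "y + d \<in> length_set B A" using y[of 0] y[of 1] l by auto
    moreover have "\<not> (y < z \<and> z < y + d)" if "z \<in> length_set B A" for z
    proof
      assume z: "y < z \<and> z < y + d"
      have "int d dvd int (z - y)" using dy[OF that] z by (simp add: of_nat_diff)
      then have "d dvd z - y" by (simp only: of_nat_dvd_iff)
      then show False using z by (auto dest: dvd_imp_le)
    qed
    ultimately show ?thesis unfolding distances_def using d1
      by (intro CollectI exI[of _ y] exI[of _ "y + d"]) auto
  qed
  have "Inf (Delta_on B (powers B A)) = d" "Delta_on B (powers B A) \<noteq> {}"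
    by (rule Inf_Delta_on_powers[OF dist], erule (1) cong)+
  then show "d \<in> Delta_rho_star B"
    unfolding Delta_rho_star_def using A el by blast
qed

text \<open>The atoms over \<open>{g, -g}\<close> are \<open>g (-g)\<close>, \<open>g\<^sup>n\<close> and \<open>(-g)\<^sup>n\<close>, of index \<open>1\<close>, \<open>1\<close> and \<open>n - 1\<close>.\<close>

lemma twin_atoms:
  assumes g: "g \<in> carrier G" "ord g = order G"
    and V: "V \<in> atoms B" "set_mset V \<subseteq> {g, inv g}"
  shows "int (order G - 2) dvd int (weight g V div order G) - 1"
proof -
  let ?n = "order G"
  have n0: "?n > 0" using order_ge3 by simp
  have Vne: "V \<noteq> {#}" using V by (auto simp: atoms_B_iff)
  consider "g \<in># V" "inv g \<in># V" | "set_mset V \<subseteq> {g}" | "set_mset V \<subseteq> {inv g}"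
    using V(2) by blast
  then have "weight g V div ?n = 1 \<or> weight g V div ?n = ?n - 1"
  proof cases
    case 1
    have sub: "{#g, inv g#} \<subseteq># V"
      using 1 inv_generator(2)[OF g] by (simp add: insert_subset_eq_iff in_diff_count)
    have "weight g {#g, inv g#} = ?n"
      using dlog_self[OF g] inv_generator[OF g] order_ge3 by (simp add: weight_def)
    moreover from this have "{#g, inv g#} \<in> carrier B"
      using zero_sum_iff_dvd_weight[OF g, of "{#g, inv g#}"] g by simp
    ultimately show ?thesis using V(1) sub n0 unfolding atoms_B_iff by auto
  next
    case 2
    then obtain k where "V = replicate_mset k g" by (metis set_mset_subset_singletonD)
    then have "V = replicate_mset ?n g" using replicate_atom_ord V(1) g(2) by metis
    then show ?thesis using n0 dlog_self[OF g] by (simp add: weight_replicate)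
  next
    case 3
    then obtain k where k: "V = replicate_mset k (inv g)" by (metis set_mset_subset_singletonD)
    then have "V = replicate_mset ?n (inv g)" using replicate_atom_ord[of k "inv g"] V(1) g by simp
    then show ?thesis using n0 inv_generator(1)[OF g] by (simp add: weight_replicate)
  qed
  then show ?thesis using order_ge3 by (auto simp: of_nat_diff)
qed

lemma order_minus_2_mem: "order G - 2 \<in> Delta_rho_star B"
proof -
  let ?d = "order G - 2"
  obtain g where g: "g \<in> carrier G" "ord g = order G" using generator by auto
  have cong: "int ?d dvd int x - int x'"
    if "x \<in> length_set B (repeat_mset m (twin g))" "x' \<in> length_set B (repeat_mset m (twin g))" for m x x'
  proof -
    have sub: "set_mset (repeat_mset m (twin g)) \<subseteq> {g, inv g}"
      using set_mset_repeat_subset[of m "twin g"] by (auto simp: twin_def split: if_splits)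
    show ?thesis
      using dvd_diff[OF length_cong_index[OF g twin_atoms[OF g] sub that(2)]
          length_cong_index[OF g twin_atoms[OF g] sub that(1)]] by simp
  qed
  have dist: "?d \<in> distances (length_set B (twin g))"
  proof -
    have "\<not> (2 < z \<and> z < order G)" if "z \<in> length_set B (twin g)" for z
    proof
      assume z: "2 < z \<and> z < order G"
      have "int ?d dvd int z - int 2"
        using cong[of z 1 2] that twin_lengths(1)[OF g] by (metis repeat_mset_1)
      then have "int ?d dvd int (z - 2)" using z by (simp add: of_nat_diff)
      then have "?d dvd z - 2" by (simp only: of_nat_dvd_iff)
      then show False using z by (auto dest: dvd_imp_le)
    qed
    then show ?thesis unfolding distances_def using twin_lengths[OF g] order_ge3
      by (intro CollectI exI[of _ 2] exI[of _ "order G"]) auto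
  qed
  have "Inf (Delta_on B (powers B (twin g))) = ?d" "Delta_on B (powers B (twin g)) \<noteq> {}"
    by (rule Inf_Delta_on_powers[OF dist], erule (1) cong)+
  moreover have "set_elasticity (length_set B (twin g)) = elasticity B"
    unfolding extremal_iff[OF twin_carrier(1)[OF g]] using twin_lengths[OF g] twin_carrier(2)[OF g]
    by (intro conjI bexI[of _ 2] bexI[of _ "order G"]) simp_all
  ultimately show ?thesis
    unfolding Delta_rho_star_def using twin_carrier(1)[OF g]
    by (intro CollectI exI[of _ "twin g"]) simp
qed

end

lemma (in group) cyclic_generator_ord:
  assumes "cyclic_group G"
  obtains g where "g \<in> carrier G" "ord g = order G"
proof -
  obtain g where g: "g \<in> carrier G" "subgroup_generated G {g} = G"
    using assms by (auto simp: cyclic_group_def)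
  then have "ord g = order G" using cyclic_order_is_ord[OF g(1)] g(2) by simp
  then show ?thesis using that g by blast
qed

theorem theorem3p14:
  fixes H :: "('a, 'm) monoid_scheme"
    and G :: "('g, 'n) monoid_scheme"
    and n :: nat
  assumes "group G" and "cyclic_group G" and "finite (carrier G)"
    and "order G = n" and "n \<ge> 3"
    and "transfer_krull_monoid H G"
  shows "n - 2 \<in> Delta_rho_star H \<and> Delta_rho_star H = Delta_rho H"
proof -
  interpret G: group G by fact
  interpret G: comm_group G using G.cyclic_imp_abelian_group assms(2) by blast
  obtain g where "g \<in> carrier G" "G.ord g = order G"
    using G.cyclic_generator_ord[OF assms(2)] .
  then interpret G: cyclic_ge3 G
    using assms by unfold_locales auto
  obtain \<theta> where "weak_transfer_hom H (zero_sum_monoid G) \<theta>"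
    using assms(6) by (auto simp: transfer_krull_monoid_def)
  then interpret T: reduced_weak_transfer H "zero_sum_monoid G" \<theta>
    by (intro reduced_weak_transfer.intro) (simp_all add: G.comm_monoid_B G.Units_B)
  show ?thesis
    using G.order_minus_2_mem G.Delta_rho_star_subset G.Delta_rho_subset assms(4)
    by (simp add: T.Delta_rho_eq T.Delta_rho_star_eq)
qed

end
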